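(* Let $b\ge2$ be an integer, let $c\ge2$ be real, put $\alpha=\log_b c$, $\rho=\{\alpha\}$, and assume $0<\rho<1$. Put $C=b^\rho$, $L=\log C$, $\Phi(x)=\rho x-\log_b x$ and $\Psi(x)=\rho x-\log_b(x+1)$. Then for every integer $m\ge1$, $$\mathbf 1_{\{m\in\mathcal S_{c,b}\}}=\lfloor\Phi(m)\rfloor-\lfloor\Psi(m)\rfloor .$$ For all sufficiently large integers $j$, define $$x_j=-\frac1L W_{-1}(-Lb^{-j}),\qquad z_j=-\frac1L W_{-1}\left(-\frac{L}{Cb^j}\right)-1 .$$ Then, for all sufficiently large $j$, the integers belonging to layer $j$ are exactly $\mathbb Z\cap[x_j,z_j)$, and $0<z_j-x_j<1$. Thus the unique possible candidate in layer $j$ is $m_j=\lceil x_j\rceil$, and it is a solution (i.e. $m_j$ is an element of $\mathcal S_{c,b}$ belonging to layer $j$) if and only if $\lceil x_j\rceil<z_j$. Moreover, $$z_j-x_j=\frac1{j\log b}+O_{c,b}\left(\frac{\log j}{j^2}\right),$$ and, with $d_+(x)=\lceil x\rceil-x$, the set $\mathcal S_{c,b}$ is infinite if and only if $d_+(x_j)<z_j-x_j$ for infinitely many $j$.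
   Context: $\mathcal S_{c,b}$ is the set of integers $m\ge1$ for which there is an integer $k\ge0$ with $mb^k\le c^m<(m+1)b^k$. $\{x\}=x-\lfloor x\rfloor$; $\log$ is the natural logarithm. $W_{-1}$ is the real branch of the Lambert $W$ function (inverse of $w\mapsto we^w$) on $[-e^{-1},0)$ with values in $(-\infty,-1]$. An integer $m\ge1$ is said to belong to layer $j$ ($j\in\mathbb Z$) if $\Psi(m)<j\le\Phi(m)$. *)

theory Defs
  imports Complex_Main "HOL-Library.Landau_Symbols" "HOL-Library.Indicator_Function"
begin

definition sols :: "real \<Rightarrow> int \<Rightarrow> int set" where
  "sols c b = {m. 1 \<le> m \<and>
     (\<exists>k::nat. of_int m * of_int b ^ k \<le> c powi m \<and> c powi m < (of_int m + 1) * of_int b ^ k)}"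

definition rho :: "real \<Rightarrow> int \<Rightarrow> real" where
  "rho c b = frac (log (of_int b) c)"

definition CC :: "real \<Rightarrow> int \<Rightarrow> real" where
  "CC c b = of_int b powr rho c b"

definition LL :: "real \<Rightarrow> int \<Rightarrow> real" where
  "LL c b = ln (CC c b)"

definition Phi :: "real \<Rightarrow> int \<Rightarrow> real \<Rightarrow> real" where
  "Phi c b x = rho c b * x - log (of_int b) x"

definition Psi :: "real \<Rightarrow> int \<Rightarrow> real \<Rightarrow> real" where
  "Psi c b x = rho c b * x - log (of_int b) (x + 1)"

definition layer :: "real \<Rightarrow> int \<Rightarrow> int \<Rightarrow> int set" where
  "layer c b j = {m. 1 \<le> m \<and> Psi c b (of_int m) < of_int j \<and> of_int j \<le> Phi c b (of_int m)}"

(* The real branch W_{-1} of the Lambert W function.  The map w |-> w e^w is a bijection from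
   (-oo,-1] onto [-1/e,0); outside that interval the value below is unspecified. *)
definition Lambert_Wm1 :: "real \<Rightarrow> real" where
  "Lambert_Wm1 = the_inv_into {..-1} (\<lambda>w. w * exp w)"

(* The arguments of W_{-1} in the definitions of x_j and z_j; they lie in [-1/e,0) only for
   j large enough. *)
definition xarg :: "real \<Rightarrow> int \<Rightarrow> int \<Rightarrow> real" where
  "xarg c b j = - LL c b * of_int b powi (- j)"

definition zarg :: "real \<Rightarrow> int \<Rightarrow> int \<Rightarrow> real" where
  "zarg c b j = - (LL c b / (CC c b * of_int b powi j))"

definition xx :: "real \<Rightarrow> int \<Rightarrow> int \<Rightarrow> real" where
  "xx c b j = - (1 / LL c b) * Lambert_Wm1 (xarg c b j)"

definition zz :: "real \<Rightarrow> int \<Rightarrow> int \<Rightarrow> real" where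
  "zz c b j = - (1 / LL c b) * Lambert_Wm1 (zarg c b j) - 1"

definition dplus :: "real \<Rightarrow> real" where
  "dplus x = of_int \<lceil>x\<rceil> - x"

end

theory Submission
  imports Defs "HOL-Real_Asymp.Real_Asymp"
begin

text \<open>
  Write \<open>\<beta> = ln b\<close> and \<open>g x = L x - ln x\<close>. Since \<open>L = \<rho> \<beta>\<close>, both counting functions are rescalings
  of \<open>g\<close>: \<open>\<Phi> x = g x / \<beta>\<close> and \<open>\<Psi> x = (g (x + 1) - L) / \<beta>\<close>. On a logarithmic scale to base \<open>b\<close>
  the condition \<open>m b\<^sup>k \<le> c\<^sup>m < (m + 1) b\<^sup>k\<close> reads \<open>\<Psi> m < j \<le> \<Phi> m\<close> with
  \<open>j = k - \<lfloor>log\<^sub>b c\<rfloor> m\<close>; conversely such a \<open>k\<close> is nonnegative because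
  \<open>c\<^sup>m \<ge> 2\<^sup>m \<ge> m + 1\<close>. The
  interval \<open>(\<Psi> m, \<Phi> m]\<close> has length \<open>log\<^sub>b ((m + 1) / m) \<le> 1\<close>, so it contains at most one integer.
  This is the floor formula (\<open>indicator_sols_eq\<close>), and it also shows that every solution has exactly
  one layer (\<open>sols_iff_layer\<close>, \<open>layer_index\<close>).

  The function \<open>g\<close> increases on \<open>[1 / L, \<infinity>)\<close>, and the branch \<open>W\<^sub>-\<^sub>1\<close> inverts it there: the larger
  root of \<open>g x = s\<close> is \<open>big_root L s = - W\<^sub>-\<^sub>1 (- L e\<^sup>-\<^sup>s) / L\<close>. For large \<open>s\<close> the smaller root lies
  below 1, where it does not concern positive integers, so \<open>s \<le> g y\<close> means \<open>big_root L s \<le> y\<close>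
  (\<open>big_root_le_iff\<close>). With \<open>s = j \<beta>\<close> one has \<open>x\<^sub>j = big_root L s\<close> and
  \<open>z\<^sub>j + 1 = big_root L (s + L)\<close>, whence layer \<open>j\<close> is \<open>\<int> \<inter> [x\<^sub>j, z\<^sub>j)\<close> (\<open>layer_eq\<close>).

  Subtracting the equations for the two roots gives, for \<open>X = x\<^sub>j\<close> and \<open>d = z\<^sub>j - x\<^sub>j\<close>, the identity
  \<open>L d = ln (1 + (1 + d) / X)\<close> with \<open>0 < d < 1\<close> (\<open>big_root_gap\<close>). Hence \<open>d = 1 / (L X) + O(1 / X\<^sup>2)\<close>.
  As \<open>L X = s + ln X\<close>, replacing \<open>L X\<close> by \<open>s = j \<beta>\<close> costs at most \<open>ln X / s\<^sup>2 = O(ln j / j\<^sup>2)\<close>.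

  Finally, every high layer has at most one element and all the low layers together are finite, so
  there are infinitely many solutions exactly when infinitely many high layers are inhabited
  (\<open>infinite_sols_iff\<close>).
\<close>

section \<open>The function L x - ln x and its larger inverse branch\<close>

definition lin_minus_ln :: "real \<Rightarrow> real \<Rightarrow> real" where
  "lin_minus_ln L x = L * x - ln x"

text \<open>
  The parameter \<open>s\<close> enters through \<open>e\<^sup>-\<^sup>s\<close> because \<open>L x - ln x = s\<close> is equivalent to
  \<open>(- L x) exp (- L x) = - L e\<^sup>-\<^sup>s\<close>. The branch \<open>W\<^sub>-\<^sub>1\<close> picks the solution with \<open>L x \<ge> 1\<close>.
\<close>

definition big_root :: "real \<Rightarrow> real \<Rightarrow> real" where
  "big_root L s = - (1 / L) * Lambert_Wm1 (- L * exp (- s))"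

text \<open>
  The derivative \<open>L - 1 / x\<close> is nonnegative from \<open>x = 1 / L\<close> on. The same fact without calculus:
  \<open>ln (y / x) < y / x - 1 \<le> L (y - x)\<close>.
\<close>

lemma lin_minus_ln_strict_mono:
  assumes "0 < x" "1 \<le> L * x" "x < y"
  shows "lin_minus_ln L x < lin_minus_ln L y"
proof -
  have "y / x \<noteq> 1" "0 < y / x" using assms by auto
  hence "ln (y / x) < y / x - 1"
    using ln_eq_minus_one[of "y / x"] ln_le_minus_one[of "y / x"] by force
  also have "\<dots> = (y - x) / x" using assms by (simp add: field_simps)
  also have "\<dots> \<le> L * (y - x)"
  proof -
    have "1 * (y - x) \<le> (L * x) * (y - x)"
      using assms by (intro mult_right_mono) auto
    thus ?thesis using assms by (simp add: field_simps)
  qed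
  finally show ?thesis
    using assms by (simp add: lin_minus_ln_def ln_div algebra_simps)
qed

lemma lin_minus_ln_less_iff:
  assumes "0 < L" "1 \<le> L * x" "1 \<le> L * y"
  shows "lin_minus_ln L x < lin_minus_ln L y \<longleftrightarrow> x < y"
proof -
  have "0 < x" "0 < y"
    using assms by (smt (verit) mult_nonneg_nonpos)+
  thus ?thesis
    using lin_minus_ln_strict_mono[of x L y] lin_minus_ln_strict_mono[of y L x] assms
    by (cases x y rule: linorder_cases) auto
qed

text \<open>
  Applying \<open>- ln (- _)\<close> turns \<open>w e\<^sup>w\<close> into \<open>p - ln p\<close> with \<open>p = - w \<ge> 1\<close>, that is, into the function
  above for \<open>L = 1\<close>. So monotonicity there gives injectivity, and the intermediate value theorem
  gives surjectivity onto \<open>[- 1 / e, 0)\<close>.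
\<close>

lemma Lambert_Wm1_inj: "inj_on (\<lambda>w::real. w * exp w) {..-1}"
proof (rule inj_onI)
  fix v w :: real
  assume vw: "v \<in> {..-1}" "w \<in> {..-1}" and eq: "v * exp v = w * exp w"
  have "ln ((-v) * exp v) = ln ((-w) * exp w)" using eq by simp
  moreover have "ln ((-v) * exp v) = ln (-v) + v" "ln ((-w) * exp w) = ln (-w) + w"
    using vw by (subst ln_mult_pos; simp)+
  ultimately have "lin_minus_ln 1 (-v) = lin_minus_ln 1 (-w)"
    by (simp add: lin_minus_ln_def)
  thus "v = w"
    using lin_minus_ln_less_iff[of 1 "-v" "-w"] lin_minus_ln_less_iff[of 1 "-w" "-v"] vw
    by auto
qed

lemma Lambert_Wm1:
  assumes "y \<in> {- exp (-1)..<0}"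
  shows "Lambert_Wm1 y \<le> -1" "Lambert_Wm1 y * exp (Lambert_Wm1 y) = y"
proof -
  define s where "s = - ln (- y)"
  have "ln (-y) \<le> ln (exp (-1))"
    using assms by (subst ln_le_cancel_iff) auto
  hence s: "s \<ge> 1" by (simp add: s_def)
  \<comment> \<open>The right end point \<open>2 s\<close> is far enough: \<open>ln (2 s) = ln 2 + ln s \<le> 1 + (s - 1)\<close>.\<close>
  have "\<exists>p. 1 \<le> p \<and> p \<le> 2 * s \<and> lin_minus_ln 1 p = s"
  proof (rule IVT')
    have "ln (2 * s) \<le> s"
      using s ln_le_minus_one[of s] ln_le_minus_one[of "2::real"] by (simp add: ln_mult)
    thus "s \<le> lin_minus_ln 1 (2 * s)" by (simp add: lin_minus_ln_def)
    show "continuous_on {1..2 * s} (lin_minus_ln 1)"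
      unfolding lin_minus_ln_def by (intro continuous_intros) auto
  qed (use s in \<open>auto simp: lin_minus_ln_def\<close>)
  then obtain p where p: "1 \<le> p" "p - ln p = s" by (auto simp: lin_minus_ln_def)
  have "p * exp (- p) = exp (ln p - p)" using p by (simp add: exp_diff exp_minus field_simps)
  also have "\<dots> = exp (- s)" using p by (simp add: algebra_simps)
  also have "\<dots> = - y" using assms by (simp add: s_def)
  finally have "y \<in> (\<lambda>w. w * exp w) ` {..-1}"
    using p by (intro image_eqI[of _ _ "-p"]) auto
  thus "Lambert_Wm1 y \<le> -1" "Lambert_Wm1 y * exp (Lambert_Wm1 y) = y"
    unfolding Lambert_Wm1_def
    using the_inv_into_into[OF Lambert_Wm1_inj, of y "{..-1}"]
          f_the_inv_into_f[OF Lambert_Wm1_inj, of y] by auto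
qed

lemma Lambert_arg_range:
  fixes L s :: real
  assumes "0 < L" "1 + ln L \<le> s"
  shows "- L * exp (- s) \<in> {- exp (-1)..<0}"
proof -
  have "L * exp (- s) = exp (ln L - s)" using assms(1) by (simp add: exp_diff exp_minus divide_inverse)
  also have "\<dots> \<le> exp (-1)" using assms by simp
  finally show ?thesis using assms by simp
qed

lemma big_root:
  assumes "0 < L" "1 + ln L \<le> s"
  shows "1 \<le> L * big_root L s" "lin_minus_ln L (big_root L s) = s"
proof -
  let ?X = "big_root L s"
  note W = Lambert_Wm1[OF Lambert_arg_range[OF assms]]
  have LX: "Lambert_Wm1 (- L * exp (- s)) = - (L * ?X)"
    using assms by (simp add: big_root_def)
  show 1: "1 \<le> L * ?X" using W(1) LX by simp
  have X: "0 < ?X" using 1 assms by (smt (verit) mult_nonneg_nonpos)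
  have "L * (?X * exp (- (L * ?X))) = L * exp (- s)" using W(2) unfolding LX by simp
  hence "?X * exp (- (L * ?X)) = exp (- s)" using assms by simp
  hence "ln (?X * exp (- (L * ?X))) = - s" by simp
  thus "lin_minus_ln L ?X = s" using X by (simp add: ln_mult lin_minus_ln_def)
qed

text \<open>
  When \<open>L < 1\<close>, the bound \<open>L x \<ge> 1\<close> already gives this; otherwise a root below 1 would have level at
  most that of the point 1, which is \<open>L\<close>.
\<close>

lemma big_root_ge_1:
  assumes "0 < L" "1 + ln L \<le> s" "L < s"
  shows "1 \<le> big_root L s"
proof (rule ccontr)
  assume "\<not> 1 \<le> big_root L s"
  moreover have "0 < big_root L s"
    using big_root(1)[OF assms(1,2)] assms(1) by (smt (verit) mult_nonneg_nonpos)
  ultimately have "lin_minus_ln L (big_root L s) < lin_minus_ln L 1"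
    using lin_minus_ln_strict_mono[of "big_root L s" L 1] big_root(1)[OF assms(1,2)] by auto
  thus False using big_root(2)[OF assms(1,2)] assms by (simp add: lin_minus_ln_def)
qed

text \<open>
  On \<open>[1 / L, \<infinity>)\<close> this is monotonicity. A point \<open>y \<ge> 1\<close> to the left of \<open>1 / L\<close> has level at most
  \<open>L y < 1 < s\<close>, so both sides fail there; this is how the smaller root is ruled out.
\<close>

lemma big_root_le_iff:
  assumes "0 < L" "1 + ln L \<le> s" "1 < s" "1 \<le> y"
  shows "s \<le> lin_minus_ln L y \<longleftrightarrow> big_root L s \<le> y"
proof (cases "1 \<le> L * y")
  case True
  thus ?thesis
    using lin_minus_ln_less_iff[of L y "big_root L s"] big_root[OF assms(1,2)] assms(1) by auto
next
  case False
  hence "lin_minus_ln L y < s" using assms by (smt (verit) lin_minus_ln_def ln_ge_zero)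
  moreover have "y < big_root L s"
    using False big_root(1)[OF assms(1,2)] assms(1)
    by (smt (verit) mult_left_mono)
  ultimately show ?thesis by auto
qed

section \<open>The gap between the roots at levels s and s + L\<close>

text \<open>The root satisfies \<open>L X = s + ln X\<close>, and \<open>ln X \<ge> 0\<close>.\<close>

lemma big_root_ge:
  assumes "0 < L" "1 + ln L \<le> s" "L < s"
  shows "s \<le> L * big_root L s"
  using big_root(2)[OF assms(1,2)] big_root_ge_1[OF assms]
  by (smt (verit) lin_minus_ln_def ln_ge_zero)

text \<open>
  Raising the level by \<open>L\<close> moves the root by slightly more than 1, because \<open>L x\<close> alone accounts for a
  shift of 1 and the logarithm has to be compensated. The shift stays below 2 since the level of
  \<open>X + 2\<close> is too high: \<open>ln ((X + 2) / X) \<le> 2 / X < L\<close>, which is where \<open>s > 2\<close> enters.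
\<close>

lemma big_root_gap:
  assumes "0 < L" "1 + ln L \<le> s" "L < s" "2 < s"
  defines "X \<equiv> big_root L s" and "d \<equiv> big_root L (s + L) - 1 - big_root L s"
  shows "0 < d" "d < 1" "L * d = ln (1 + (1 + d) / X)"
proof -
  let ?Y = "big_root L (s + L)"
  have s': "1 + ln L \<le> s + L" using assms by simp
  note X = big_root[OF assms(1,2), folded X_def] and Y = big_root[OF assms(1) s']
  have X1: "1 \<le> X" using big_root_ge_1[OF assms(1-3)] by (simp add: X_def)
  have X2: "2 < L * X" using big_root_ge[OF assms(1-3)] assms by (simp add: X_def)
  have "ln X < ln (X + 1)" using X1 by (subst ln_less_cancel_iff) auto
  hence "lin_minus_ln L (X + 1) < lin_minus_ln L ?Y"
    using X(2) Y(2) by (simp add: lin_minus_ln_def algebra_simps)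
  hence "X + 1 < ?Y"
    using lin_minus_ln_less_iff[OF assms(1) _ Y(1), of "X + 1"] X(1) assms(1)
    by (simp add: algebra_simps)
  thus d0: "0 < d" by (simp add: d_def X_def)
  have "ln (X + 2) - ln X = ln ((X + 2) / X)" using X1 by (subst ln_divide_pos) auto
  also have "(X + 2) / X = 1 + 2 / X" using X1 by (simp add: field_simps)
  also have "ln (1 + 2 / X) \<le> 2 / X" using X1 by (intro ln_add_one_self_le_self) auto
  also have "\<dots> < L" using X1 X2 by (simp add: field_simps)
  finally have "lin_minus_ln L ?Y < lin_minus_ln L (X + 2)"
    using X(2) Y(2) by (simp add: lin_minus_ln_def algebra_simps)
  hence "?Y < X + 2"
    using lin_minus_ln_less_iff[OF assms(1) Y(1), of "X + 2"] X(1) assms(1)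
    by (simp add: algebra_simps)
  thus "d < 1" by (simp add: d_def X_def)
  have "L * d = ln (X + 1 + d) - ln X"
    using X(2) Y(2) by (simp add: lin_minus_ln_def d_def X_def algebra_simps)
  also have "\<dots> = ln ((X + 1 + d) / X)" using X1 d0 by (subst ln_divide_pos) auto
  also have "(X + 1 + d) / X = 1 + (1 + d) / X" using X1 by (simp add: field_simps)
  finally show "L * d = ln (1 + (1 + d) / X)" .
qed

text \<open>
  The upper bound feeds the crude estimate \<open>d \<le> 2 / (L X)\<close>, which follows from \<open>d < 1\<close>, back into
  \<open>L d \<le> (1 + d) / X\<close>. The lower bound drops \<open>d\<close> on the right-hand side of the equation and uses
  \<open>ln (1 + h) \<ge> h - h\<^sup>2\<close> with \<open>h = 1 / X\<close>.
\<close>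

lemma gap_estimate:
  fixes L X d :: real
  assumes "0 < L" "1 \<le> X" "0 < d" "d < 1" "L * d = ln (1 + (1 + d) / X)"
  shows "\<bar>d - 1 / (L * X)\<bar> \<le> (2 / L\<^sup>2 + 1 / L) / X\<^sup>2"
proof -
  have up: "L * d \<le> (1 + d) / X"
    unfolding assms(5) using assms by (intro ln_add_one_self_le_self) auto
  also have "\<dots> \<le> 2 / X" using assms by (simp add: divide_right_mono)
  finally have "L * d \<le> 2 / X" .
  hence "d \<le> 2 / (L * X)" using assms(1,2) by (simp add: field_simps)
  hence "d / X \<le> 2 / (L * X) / X" using assms by (intro divide_right_mono) auto
  hence "L * d \<le> 1 / X + 2 / (L * X) / X" using up by (simp add: add_divide_distrib)
  hence "d \<le> (1 / X + 2 / (L * X) / X) / L"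
    using assms(1) by (simp only: pos_le_divide_eq mult.commute)
  also have "\<dots> = 1 / (L * X) + (2 / L\<^sup>2) / X\<^sup>2"
    using assms by (simp add: field_simps power2_eq_square)
  finally have 1: "d - 1 / (L * X) \<le> (2 / L\<^sup>2) / X\<^sup>2" by simp
  have "1 / X - (1 / X)\<^sup>2 \<le> ln (1 + 1 / X)"
    using assms by (intro ln_one_plus_pos_lower_bound) auto
  also have "\<dots> \<le> L * d"
    unfolding assms(5) using assms
    by (subst ln_le_cancel_iff) (auto simp: divide_right_mono add_pos_nonneg)
  finally have "(1 / X - (1 / X)\<^sup>2) / L \<le> d"
    using assms(1) by (simp only: pos_divide_le_eq mult.commute)
  moreover have "(1 / X - (1 / X)\<^sup>2) / L = 1 / (L * X) - (1 / L) / X\<^sup>2"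
    using assms by (simp add: field_simps power2_eq_square)
  ultimately have 2: "1 / (L * X) - d \<le> (1 / L) / X\<^sup>2" by simp
  have "0 \<le> (2 / L\<^sup>2) / X\<^sup>2" "0 \<le> (1 / L) / X\<^sup>2" using assms by auto
  with 1 2 show ?thesis unfolding add_divide_distrib abs_le_iff by linarith
qed

lemma reciprocal_root_estimate:
  fixes L X s :: real
  assumes "0 < s" "1 \<le> X" "lin_minus_ln L X = s"
  shows "\<bar>1 / (L * X) - 1 / s\<bar> \<le> ln X / s\<^sup>2"
proof -
  have LX: "L * X = s + ln X" and lX: "0 \<le> ln X"
    using assms by (auto simp: lin_minus_ln_def)
  have "s \<noteq> 0" "s + ln X \<noteq> 0" using assms(1) lX by auto
  hence "1 / s - 1 / (L * X) = ln X / (s * (s + ln X))"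
    unfolding LX by (simp add: divide_simps)
  moreover have "\<dots> \<le> ln X / s\<^sup>2"
    using assms(1) lX
    by (intro divide_left_mono) (auto simp: power2_eq_square intro!: mult_pos_pos add_pos_nonneg)
  moreover have "0 \<le> ln X / (s * (s + ln X))" using assms lX by simp
  ultimately show ?thesis by simp
qed

lemma big_root_gap_estimate:
  assumes "0 < L" "1 + ln L \<le> s" "L < s" "2 < s"
  shows "\<bar>big_root L (s + L) - 1 - big_root L s - 1 / s\<bar>
           \<le> (2 + L + ln (big_root L s)) / s\<^sup>2"
proof -
  let ?X = "big_root L s" and ?d = "big_root L (s + L) - 1 - big_root L s"
  have X1: "1 \<le> ?X" by (rule big_root_ge_1[OF assms(1-3)])
  have "s\<^sup>2 \<le> (L * ?X)\<^sup>2"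
    using big_root_ge[OF assms(1-3)] assms by (intro power_mono) auto
  hence "(2 + L) / (L * ?X)\<^sup>2 \<le> (2 + L) / s\<^sup>2"
    using assms X1 by (intro divide_left_mono) auto
  moreover have "(2 / L\<^sup>2 + 1 / L) / ?X\<^sup>2 = (2 + L) / (L * ?X)\<^sup>2"
    using assms X1 by (simp add: field_simps power2_eq_square)
  moreover have "\<bar>?d - 1 / (L * ?X)\<bar> \<le> (2 / L\<^sup>2 + 1 / L) / ?X\<^sup>2"
    by (rule gap_estimate[OF assms(1) X1 big_root_gap[OF assms]])
  moreover have "\<bar>1 / (L * ?X) - 1 / s\<bar> \<le> ln ?X / s\<^sup>2"
    by (rule reciprocal_root_estimate) (use assms X1 big_root in auto)
  ultimately show ?thesis by (simp add: add_divide_distrib)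
qed

text \<open>
  Only \<open>ln X = O(ln t)\<close> is required of the root, so any polynomial bound will do. The square is
  convenient because its level \<open>L t\<^sup>2 - 2 ln t\<close> visibly exceeds \<open>t \<beta>\<close> in the end.
\<close>

lemma big_root_le_square:
  assumes "0 < L" "0 < \<beta>"
  shows "eventually (\<lambda>t. big_root L (t * \<beta>) \<le> t\<^sup>2) at_top"
proof -
  have "eventually (\<lambda>t::real. 1 + ln L \<le> t * \<beta>) at_top"
    "eventually (\<lambda>t::real. 1 < t * \<beta>) at_top"
    "eventually (\<lambda>t::real. t * \<beta> \<le> L * t\<^sup>2 - ln (t\<^sup>2)) at_top"
    using assms by real_asymp+
  moreover have "eventually (\<lambda>t::real. 1 \<le> t\<^sup>2) at_top" by real_asymp
  ultimately show ?thesis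
  proof eventually_elim
    case (elim t)
    thus ?case using big_root_le_iff[of L "t * \<beta>" "t\<^sup>2"] assms by (simp add: lin_minus_ln_def)
  qed
qed

lemma big_root_gap_bigo:
  assumes "0 < L" "0 < \<beta>"
  shows "(\<lambda>t. big_root L (t * \<beta> + L) - 1 - big_root L (t * \<beta>) - 1 / (t * \<beta>))
           \<in> O[at_top](\<lambda>t. ln t / t\<^sup>2)"
proof (rule landau_o.big_trans)
  show "(\<lambda>t. (2 + L + 2 * ln t) / (t * \<beta>)\<^sup>2) \<in> O[at_top](\<lambda>t::real. ln t / t\<^sup>2)"
    using assms by real_asymp
  have ev: "eventually (\<lambda>t::real. 1 + ln L \<le> t * \<beta>) at_top"
    "eventually (\<lambda>t::real. L < t * \<beta>) at_top" "eventually (\<lambda>t::real. 2 < t * \<beta>) at_top"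
    using assms by real_asymp+
  have "eventually (\<lambda>t. norm (big_root L (t * \<beta> + L) - 1 - big_root L (t * \<beta>) - 1 / (t * \<beta>))
          \<le> norm ((2 + L + 2 * ln t) / (t * \<beta>)\<^sup>2)) at_top"
    using ev big_root_le_square[OF assms] eventually_gt_at_top[of 1]
  proof eventually_elim
    case (elim t)
    let ?X = "big_root L (t * \<beta>)"
    have X1: "1 \<le> ?X" by (rule big_root_ge_1) (use elim assms in auto)
    have "ln ?X \<le> ln (t\<^sup>2)" using X1 elim by (subst ln_le_cancel_iff) auto
    also have "\<dots> = 2 * ln t" using elim by (simp add: ln_realpow)
    finally have "(2 + L + ln ?X) / (t * \<beta>)\<^sup>2 \<le> (2 + L + 2 * ln t) / (t * \<beta>)\<^sup>2"
      by (intro divide_right_mono) auto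
    moreover have "0 \<le> (2 + L + 2 * ln t) / (t * \<beta>)\<^sup>2"
      using assms elim by (intro divide_nonneg_nonneg) auto
    ultimately show ?case
      using big_root_gap_estimate[of L "t * \<beta>"] elim assms by simp
  qed
  thus "(\<lambda>t. big_root L (t * \<beta> + L) - 1 - big_root L (t * \<beta>) - 1 / (t * \<beta>))
      \<in> O[at_top](\<lambda>t. (2 + L + 2 * ln t) / (t * \<beta>)\<^sup>2)"
    by (intro landau_o.big_mono)
qed

section \<open>Solutions and layers\<close>

lemma LL_eq: "2 \<le> b \<Longrightarrow> LL c b = rho c b * ln (of_int b)"
  by (simp add: LL_def CC_def ln_powr)

lemma Phi_eq:
  assumes "2 \<le> b"
  shows "Phi c b x = lin_minus_ln (LL c b) x / ln (of_int b)"
  using assms by (simp add: Phi_def LL_eq lin_minus_ln_def log_def field_simps)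

lemma Psi_eq:
  assumes "2 \<le> b"
  shows "Psi c b x = (lin_minus_ln (LL c b) (x + 1) - LL c b) / ln (of_int b)"
  using assms by (simp add: Psi_def LL_eq lin_minus_ln_def log_def field_simps)

lemma xarg_eq:
  assumes "2 \<le> b"
  shows "xarg c b j = - LL c b * exp (- (of_int j * ln (of_int b)))"
  using assms by (simp add: xarg_def powr_real_of_int' [symmetric] powr_def)

lemma zarg_eq:
  assumes "2 \<le> b"
  shows "zarg c b j = - LL c b * exp (- (of_int j * ln (of_int b) + LL c b))"
proof -
  have "CC c b = exp (LL c b)" using assms by (simp add: LL_def CC_def ln_powr powr_def)
  moreover have "of_int b powi j = exp (of_int j * ln (of_int b :: real))"
    using assms by (simp add: powr_real_of_int' [symmetric] powr_def)
  ultimately show ?thesis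
    by (simp add: zarg_def exp_add exp_minus exp_diff divide_simps)
qed

lemma xx_eq: "2 \<le> b \<Longrightarrow> xx c b j = big_root (LL c b) (of_int j * ln (of_int b))"
  by (simp add: xx_def big_root_def xarg_eq)

lemma zz_eq: "2 \<le> b \<Longrightarrow> zz c b j = big_root (LL c b) (of_int j * ln (of_int b) + LL c b) - 1"
  by (simp add: zz_def big_root_def zarg_eq)

text \<open>This is \<open>(m + 1) / m \<le> 2 \<le> b\<close> in logarithmic form.\<close>

lemma Phi_Psi_diff:
  fixes m :: int
  assumes "2 \<le> b" "1 \<le> m"
  shows "Phi c b (of_int m) \<le> Psi c b (of_int m) + 1"
proof -
  have "2 * m \<le> b * m" using assms by (intro mult_right_mono) auto
  hence "m + 1 \<le> b * m" using assms by linarith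
  hence "of_int (m + 1) \<le> (of_int (b * m) :: real)" by (simp only: of_int_le_iff)
  hence "log (of_int b) (of_int m + 1) \<le> log (of_int b) (of_int b * of_int m)"
    using assms by (subst log_le_cancel_iff) auto
  also have "\<dots> = 1 + log (of_int b) (of_int m)"
    using assms by (subst log_mult) auto
  finally show ?thesis by (simp add: Phi_def Psi_def)
qed

lemma layer_index:
  assumes "2 \<le> b" "m \<in> layer c b j"
  shows "j = \<lfloor>Phi c b (of_int m)\<rfloor>"
  using Phi_Psi_diff[of b m c] assms
  unfolding layer_def by (intro floor_unique[symmetric]) auto

text \<open>
  The exponent \<open>k\<close> and the layer \<open>j\<close> are related by \<open>j = k - n m\<close> with \<open>n = \<lfloor>log\<^sub>b c\<rfloor>\<close>: subtracting
  \<open>n m\<close> from \<open>k \<le> m log\<^sub>b c - log\<^sub>b m\<close> leaves the fractional part \<open>\<rho>\<close> as the slope. Conversely, a layer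
  yields a nonnegative \<open>k\<close>, since \<open>m + 1 \<le> c\<^sup>m\<close>.
\<close>

lemma sols_iff_layer:
  assumes "2 \<le> b" "2 \<le> c"
  shows "m \<in> sols c b \<longleftrightarrow> (\<exists>j. m \<in> layer c b j)"
proof (cases "1 \<le> m")
  case m: True
  define B where "B = (of_int b :: real)"
  define n where "n = \<lfloor>log B c\<rfloor>"
  have B: "2 \<le> B" using assms by (simp add: B_def)
  have rho: "rho c b = log B c - of_int n" by (simp add: rho_def frac_def n_def B_def)
  have lc: "log B (c powi m) = of_int m * log B c" and cpos: "0 < c powi m"
    using assms B by (simp_all add: powr_real_of_int' [symmetric] log_powr)
  have low: "of_int m * B ^ k \<le> c powi m \<longleftrightarrow> of_int (int k - n * m) \<le> Phi c b (of_int m)" for k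
  proof -
    have "of_int m * B ^ k \<le> c powi m \<longleftrightarrow> log B (of_int m * B ^ k) \<le> log B (c powi m)"
      using B m cpos by (subst log_le_cancel_iff) auto
    also have "log B (of_int m * B ^ k) = log B (of_int m) + of_nat k"
      using B m by (subst log_mult) (auto simp: log_nat_power)
    finally show ?thesis by (simp add: lc Phi_def rho B_def[symmetric] algebra_simps)
  qed
  have up: "c powi m < (of_int m + 1) * B ^ k \<longleftrightarrow> Psi c b (of_int m) < of_int (int k - n * m)" for k
  proof -
    have "c powi m < (of_int m + 1) * B ^ k
            \<longleftrightarrow> log B (c powi m) < log B ((of_int m + 1) * B ^ k)"
      using B m cpos by (subst log_less_cancel_iff) auto
    also have "log B ((of_int m + 1) * B ^ k) = log B (of_int m + 1) + of_nat k"
      using B m by (subst log_mult) (auto simp: log_nat_power)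
    finally show ?thesis by (simp add: lc Psi_def rho B_def[symmetric] algebra_simps)
  qed
  have nonneg: "0 \<le> j + n * m" if "Psi c b (of_int m) < of_int j" for j
  proof -
    define q where "q = nat m"
    have q: "m = int q" using m by (simp add: q_def)
    have "1 + real q \<le> 2 ^ q" using Bernoulli_inequality[of 1 q] by simp
    also have "\<dots> \<le> c ^ q" using assms by (intro power_mono) auto
    finally have "of_int m + 1 \<le> c powi m" by (simp add: q)
    hence "log B (of_int m + 1) \<le> of_int m * log B c"
      unfolding lc[symmetric] using B m cpos by (subst log_le_cancel_iff) auto
    hence "0 < of_int j + of_int n * (of_int m :: real)"
      using that by (simp add: Psi_def rho B_def[symmetric] algebra_simps)
    hence "0 < (of_int (j + n * m) :: real)" by simp
    thus ?thesis by (simp only: of_int_0_less_iff)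
  qed
  show ?thesis
  proof
    assume "m \<in> sols c b"
    then obtain k :: nat where "of_int m * B ^ k \<le> c powi m" "c powi m < (of_int m + 1) * B ^ k"
      by (auto simp: sols_def B_def)
    hence "m \<in> layer c b (int k - n * m)" unfolding low up layer_def using m by simp
    thus "\<exists>j. m \<in> layer c b j" ..
  next
    assume "\<exists>j. m \<in> layer c b j"
    then obtain j where j: "Psi c b (of_int m) < of_int j" "of_int j \<le> Phi c b (of_int m)"
      by (auto simp: layer_def)
    have "int (nat (j + n * m)) - n * m = j" using nonneg[OF j(1)] by simp
    hence "of_int m * B ^ nat (j + n * m) \<le> c powi m \<and>
           c powi m < (of_int m + 1) * B ^ nat (j + n * m)"
      unfolding low up using j by simp
    thus "m \<in> sols c b" unfolding sols_def B_def using m by blast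
  qed
qed (auto simp: sols_def layer_def)

lemma indicator_sols_eq:
  assumes "2 \<le> b" "2 \<le> c" "1 \<le> m"
  shows "(indicator (sols c b) m :: int) = \<lfloor>Phi c b (of_int m)\<rfloor> - \<lfloor>Psi c b (of_int m)\<rfloor>"
proof -
  let ?P = "Phi c b (of_int m)" and ?Q = "Psi c b (of_int m)"
  have "log (of_int b) (of_int m) < log (of_int b) (of_int m + 1 :: real)"
    using assms by (subst log_less_cancel_iff) auto
  hence less: "?Q < ?P" by (simp add: Phi_def Psi_def)
  have le: "?P \<le> ?Q + 1" by (rule Phi_Psi_diff) (use assms in auto)
  have "m \<in> sols c b \<longleftrightarrow> (\<exists>j. ?Q < of_int j \<and> of_int j \<le> ?P)"
    using sols_iff_layer[OF assms(1,2)] assms by (auto simp: layer_def)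
  also have "\<dots> \<longleftrightarrow> \<lfloor>?Q\<rfloor> < \<lfloor>?P\<rfloor>"
    by (metis floor_less_iff le_floor_iff less_le_trans of_int_floor_le)
  finally show ?thesis
    using floor_mono[OF le] floor_mono[OF less_imp_le[OF less]] by (auto simp: indicator_def)
qed

section \<open>High layers\<close>

text \<open>
  With \<open>s = j ln b\<close>, the first condition puts the argument of \<open>W\<^sub>-\<^sub>1\<close> into \<open>[- 1 / e, 0)\<close>, the second
  makes the larger root at least 1, and the third bounds the gap by 1. All three persist when \<open>s\<close> is
  replaced by \<open>s + L\<close>.
\<close>

definition large_index :: "real \<Rightarrow> int \<Rightarrow> int \<Rightarrow> bool" where
  "large_index c b j \<longleftrightarrow> 1 + ln (LL c b) \<le> of_int j * ln (of_int b)
     \<and> LL c b < of_int j * ln (of_int b) \<and> 2 < of_int j * ln (of_int b :: real)"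

lemma eventually_large_index:
  assumes "2 \<le> b"
  shows "\<exists>j0. \<forall>j\<ge>j0. large_index c b j"
proof -
  have "filterlim (\<lambda>j::int. of_int j * ln (of_int b :: real)) at_top at_top"
    using assms
    by (intro filterlim_at_top_mult_tendsto_pos[OF tendsto_const _ filterlim_real_of_int_at_top]) auto
  hence gt: "eventually (\<lambda>j::int. K < of_int j * ln (of_int b)) at_top" for K :: real
    by (simp add: filterlim_at_top_dense)
  have "eventually (large_index c b) at_top"
    using gt[of "1 + ln (LL c b)"] gt[of "LL c b"] gt[of 2]
    by eventually_elim (simp add: large_index_def)
  thus ?thesis by (simp add: eventually_at_top_linorder)
qed

lemma Phi_ge_iff:
  fixes m :: int
  assumes "2 \<le> b" "0 < LL c b" "large_index c b j" "1 \<le> m"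
  shows "of_int j \<le> Phi c b (of_int m) \<longleftrightarrow> xx c b j \<le> of_int m"
  using assms big_root_le_iff[of "LL c b" "of_int j * ln (of_int b)" "of_int m"]
  by (simp add: large_index_def Phi_eq xx_eq pos_le_divide_eq)

lemma Psi_less_iff:
  fixes m :: int
  assumes "2 \<le> b" "0 < LL c b" "large_index c b j" "1 \<le> m"
  shows "Psi c b (of_int m) < of_int j \<longleftrightarrow> of_int m < zz c b j"
proof -
  have "Psi c b (of_int m) < of_int j \<longleftrightarrow>
      lin_minus_ln (LL c b) (of_int m + 1) < of_int j * ln (of_int b) + LL c b"
    using assms(1) by (simp add: Psi_eq pos_divide_less_eq algebra_simps)
  also have "\<dots> \<longleftrightarrow> of_int m + 1 < big_root (LL c b) (of_int j * ln (of_int b) + LL c b)"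
    using assms big_root_le_iff[of "LL c b" "of_int j * ln (of_int b) + LL c b" "of_int m + 1"]
    by (simp add: large_index_def not_le[symmetric])
  also have "\<dots> \<longleftrightarrow> of_int m < zz c b j" using assms(1) by (auto simp: zz_eq)
  finally show ?thesis .
qed

lemma layer_eq:
  assumes "2 \<le> b" "0 < LL c b" "large_index c b j"
  shows "layer c b j = {m. xx c b j \<le> of_int m \<and> of_int m < zz c b j}"
proof -
  have "1 \<le> xx c b j"
    using big_root_ge_1[of "LL c b" "of_int j * ln (of_int b)"] assms
    by (simp add: xx_eq large_index_def)
  hence "1 \<le> m" if "xx c b j \<le> of_int m" for m
    using that by linarith
  thus ?thesis using Phi_ge_iff[OF assms] Psi_less_iff[OF assms] by (auto simp: layer_def)
qed

text \<open>
  An element determines its layer, so finitely many solutions inhabit finitely many layers.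
  Conversely, a solution in a layer below \<open>j0\<close> satisfies \<open>\<Psi> m < j0\<close> and is therefore smaller than
  \<open>z\<close> at index \<open>j0\<close>; this bounds all the low layers, including those of negative index, at once.
\<close>

lemma infinite_sols_iff:
  assumes "2 \<le> b" "2 \<le> c" "0 < LL c b" "\<forall>j\<ge>j0. large_index c b j"
    and "\<And>j. j0 \<le> j \<Longrightarrow> finite (layer c b j)"
  shows "infinite (sols c b) \<longleftrightarrow> infinite {j. j0 \<le> j \<and> layer c b j \<noteq> {}}"
proof -
  let ?J = "{j. j0 \<le> j \<and> layer c b j \<noteq> {}}"
  have "finite ?J" if "finite (sols c b)"
  proof (rule finite_subset)
    show "?J \<subseteq> (\<lambda>m. \<lfloor>Phi c b (of_int m)\<rfloor>) ` sols c b"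
      using layer_index[OF assms(1)] sols_iff_layer[OF assms(1,2)] by blast
  qed (use that in simp)
  moreover have "finite (sols c b)" if "finite ?J"
  proof (rule finite_subset)
    show "sols c b \<subseteq> {1..\<lceil>zz c b j0\<rceil>} \<union> (\<Union>j\<in>?J. layer c b j)"
    proof
      fix m assume "m \<in> sols c b"
      then obtain j where j: "m \<in> layer c b j" using sols_iff_layer[OF assms(1,2)] by blast
      show "m \<in> {1..\<lceil>zz c b j0\<rceil>} \<union> (\<Union>j\<in>?J. layer c b j)"
      proof (cases "j0 \<le> j")
        case True
        thus ?thesis using j by blast
      next
        case False
        hence "1 \<le> m" "Psi c b (of_int m) < of_int j0" using j by (auto simp: layer_def)
        hence "of_int m < zz c b j0" using Psi_less_iff[of b c j0 m] assms by auto
        thus ?thesis using \<open>1 \<le> m\<close> by (simp, linarith)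
      qed
    qed
  qed (use that assms(5) in auto)
  ultimately show ?thesis by blast
qed

theorem theorem3p1:
  fixes b :: int and c :: real
  assumes "b \<ge> 2" and "c \<ge> 2" and "0 < rho c b" and "rho c b < 1"
  shows
    "(\<forall>m::int. m \<ge> 1 \<longrightarrow>
        (indicator (sols c b) m :: int) = \<lfloor>Phi c b (of_int m)\<rfloor> - \<lfloor>Psi c b (of_int m)\<rfloor>)
   \<and> (\<exists>j0::int.
        (\<forall>j\<ge>j0.
            xarg c b j \<in> {- exp (-1)..<0} \<and> zarg c b j \<in> {- exp (-1)..<0}
          \<and> layer c b j = {m::int. xx c b j \<le> of_int m \<and> of_int m < zz c b j}
          \<and> 0 < zz c b j - xx c b j \<and> zz c b j - xx c b j < 1
          \<and> (\<forall>m \<in> layer c b j. m = \<lceil>xx c b j\<rceil>)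
          \<and> (\<lceil>xx c b j\<rceil> \<in> sols c b \<and> \<lceil>xx c b j\<rceil> \<in> layer c b j
               \<longleftrightarrow> of_int \<lceil>xx c b j\<rceil> < zz c b j))
      \<and> (infinite (sols c b) \<longleftrightarrow>
           infinite {j. j \<ge> j0 \<and> dplus (xx c b j) < zz c b j - xx c b j}))
   \<and> (\<lambda>j::int. zz c b j - xx c b j - 1 / (of_int j * ln (of_int b)))
        \<in> O[at_top](\<lambda>j. ln (of_int j) / (of_int j)\<^sup>2)"
proof (intro conjI)
  show "\<forall>m::int. m \<ge> 1 \<longrightarrow>
        (indicator (sols c b) m :: int) = \<lfloor>Phi c b (of_int m)\<rfloor> - \<lfloor>Psi c b (of_int m)\<rfloor>"
    using indicator_sols_eq assms by blast
next
  let ?s = "\<lambda>j::int. of_int j * ln (of_int b :: real)"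
  have lnb: "0 < ln (of_int b :: real)" using assms(1) by simp
  have L: "0 < LL c b" using assms lnb by (simp add: LL_eq)
  show "(\<lambda>j::int. zz c b j - xx c b j - 1 / (of_int j * ln (of_int b)))
        \<in> O[at_top](\<lambda>j. ln (of_int j) / (of_int j)\<^sup>2)"
    using landau_o.big.compose[OF big_root_gap_bigo[OF L lnb] filterlim_real_of_int_at_top] assms(1)
    by (simp add: xx_eq zz_eq algebra_simps)
  obtain j0 where j0: "\<forall>j\<ge>j0. large_index c b j" using eventually_large_index assms(1) by blast
  have gap: "0 < zz c b j - xx c b j" "zz c b j - xx c b j < 1" if "j0 \<le> j" for j
    using big_root_gap(1,2)[of "LL c b" "?s j"] j0 that L assms(1)
    by (auto simp: large_index_def xx_eq zz_eq)
  have lay: "layer c b j = {m. xx c b j \<le> of_int m \<and> of_int m < zz c b j}" if "j0 \<le> j" for j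
    using layer_eq[OF assms(1) L] j0 that by blast
  have uniq: "m = \<lceil>xx c b j\<rceil>" if "j0 \<le> j" "m \<in> layer c b j" for j m
    using gap[OF that(1)] that(2) unfolding lay[OF that(1)]
    by (intro ceiling_unique[symmetric]) auto
  have cand: "\<lceil>xx c b j\<rceil> \<in> layer c b j \<longleftrightarrow> of_int \<lceil>xx c b j\<rceil> < zz c b j" if "j0 \<le> j" for j
    unfolding lay[OF that] by simp
  have "finite (layer c b j)" if "j0 \<le> j" for j
    by (rule finite_subset[of _ "{\<lceil>xx c b j\<rceil>}"]) (use uniq[OF that] in auto)
  from infinite_sols_iff[OF assms(1,2) L j0 this]
  have "infinite (sols c b) \<longleftrightarrow> infinite {j. j0 \<le> j \<and> layer c b j \<noteq> {}}" .
  moreover have "layer c b j \<noteq> {} \<longleftrightarrow> dplus (xx c b j) < zz c b j - xx c b j" if "j0 \<le> j" for j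
    using cand[OF that] uniq[OF that] by (auto simp: dplus_def)
  hence "{j. j0 \<le> j \<and> layer c b j \<noteq> {}}
      = {j. j0 \<le> j \<and> dplus (xx c b j) < zz c b j - xx c b j}" by blast
  ultimately have inf: "infinite (sols c b) \<longleftrightarrow>
           infinite {j. j \<ge> j0 \<and> dplus (xx c b j) < zz c b j - xx c b j}" by simp
  have args: "xarg c b j \<in> {- exp (-1)..<0} \<and> zarg c b j \<in> {- exp (-1)..<0}" if "j0 \<le> j" for j
    using Lambert_arg_range[OF L, of "?s j"] Lambert_arg_range[OF L, of "?s j + LL c b"]
      j0 that L assms(1) unfolding xarg_eq[OF assms(1)] zarg_eq[OF assms(1)] large_index_def
    by (smt (verit))
  have sol: "m \<in> sols c b" if "m \<in> layer c b j" for m j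
    using sols_iff_layer[OF assms(1,2)] that by blast
  show "\<exists>j0::int.
        (\<forall>j\<ge>j0.
            xarg c b j \<in> {- exp (-1)..<0} \<and> zarg c b j \<in> {- exp (-1)..<0}
          \<and> layer c b j = {m::int. xx c b j \<le> of_int m \<and> of_int m < zz c b j}
          \<and> 0 < zz c b j - xx c b j \<and> zz c b j - xx c b j < 1
          \<and> (\<forall>m \<in> layer c b j. m = \<lceil>xx c b j\<rceil>)
          \<and> (\<lceil>xx c b j\<rceil> \<in> sols c b \<and> \<lceil>xx c b j\<rceil> \<in> layer c b j
               \<longleftrightarrow> of_int \<lceil>xx c b j\<rceil> < zz c b j))
      \<and> (infinite (sols c b) \<longleftrightarrow>
           infinite {j. j \<ge> j0 \<and> dplus (xx c b j) < zz c b j - xx c b j})"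
    using args lay gap uniq cand sol inf by (intro exI[of _ j0] conjI allI impI ballI) blast+
qed

end
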